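(* Let $\mathcal A$ be a finite or countable alphabet, $X=\mathcal A^{\mathbb N}$, $T:X\to X$ the shift, and let $g(x)=\prod_{n=1}^\infty g_n(x_n)$ be a potential of product type on $X$. (1) There exists at most one $g$-conformal measure $\mu=\otimes_{n=1}^\infty\mu_n$ of product type which is positive on (nonempty) open sets. This measure $\mu$ is given by $$\mu_n(a)=\left(\sum_{b\in\mathcal A}\prod_{i=1}^n\frac{g_i(a)}{g_i(b)}\right)^{-1}\qquad\text{for all } n\in\mathbb N,\ a\in\mathcal A.$$ (2) If $\inf_{x\in X}g(x)>0$, then a $g$-conformal measure of product type exists and is positive on (nonempty) open sets.
   Context: $X=\mathcal A^{\mathbb N}$ carries the product topology ($\mathcal A$ discrete) and its Borel $\sigma$-algebra; $T(x_1,x_2,\ldots)=(x_2,x_3,\ldots)$. A function $f:X\to\mathbb R$ is of product type if $f(x)=\sum_{n=1}^\infty f_n(x_n)$ for functions $f_n:\mathcal A\to\mathbb R$ such that the series converges for all $x\in X$. A positive function $g:X\to(0,\infty)$ is a potential of product type if $\log g$ is of product type, i.e. $g(x)=\prod_{n=1}^\infty g_n(x_n)$ with $g_n=e^{f_n}:\mathcal A\to(0,\infty)$. A measure of product type on $X$ is a product measure $\mu=\otimes_{i=1}^\infty\mu_i$, where the $\mu_i$ are probability measures on $\mathcal A$; write $\mu_i(a)=\mu_i(\{a\})$. For $\phi:X\to(0,\infty)$, a Borel probability measure $\mu$ on $X$ is $\phi$-conformal (conformal for $\phi$) if there exists $\lambda>0$ such that $\mu(T(A))=\lambda\int_A\phi\,d\mu$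 for all measurable sets $A$ such that $T|_A$ is injective.
   Formalization: Part (2) additionally assumes that the sum over b in the alphabet of 1/g_1(b) converges (automatic for finite alphabets, necessary by (1)); without it (2) fails, e.g. for g = 1 on an infinite alphabet. *)

theory Defs
  imports "HOL-Probability.Probability"
begin

text \<open>The alphabet is a type of sort \<open>{countable, discrete_topology}\<close> (finite or countably infinite,
  nonempty, discrete) and \<open>X\<close> is the type \<open>nat \<Rightarrow> 'a\<close> with the library's product topology. Coordinates
  are numbered from 0, so \<open>x n\<close>, \<open>gs n\<close>, \<open>m n\<close> stand for \<open>x\<close>, \<open>g\<close>, \<open>\<mu>\<close> with subscript \<open>n + 1\<close>.\<close>

definition shift :: "(nat \<Rightarrow> 'a) \<Rightarrow> nat \<Rightarrow> 'a" where
  "shift x = (\<lambda>n. x (Suc n))"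

definition has_product_form :: "((nat \<Rightarrow> 'a) \<Rightarrow> real) \<Rightarrow> (nat \<Rightarrow> 'a \<Rightarrow> real) \<Rightarrow> bool" where
  "has_product_form f fs \<longleftrightarrow> (\<forall>x. (\<lambda>n. fs n (x n)) sums f x)"

text \<open>\<open>g x\<close> is the infinite product of the \<open>gs n (x n)\<close>; convergence is that of the series of logarithms.\<close>

definition product_potential :: "((nat \<Rightarrow> 'a) \<Rightarrow> real) \<Rightarrow> (nat \<Rightarrow> 'a \<Rightarrow> real) \<Rightarrow> bool" where
  "product_potential g gs \<longleftrightarrow>
     (\<forall>x. 0 < g x) \<and> (\<forall>n a. 0 < gs n a) \<and>
     has_product_form (\<lambda>x. ln (g x)) (\<lambda>n a. ln (gs n a))"

definition prob_family :: "(nat \<Rightarrow> 'a measure) \<Rightarrow> bool" where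
  "prob_family m \<longleftrightarrow> (\<forall>n. prob_space (m n) \<and> sets (m n) = UNIV)"

definition product_type_measure :: "(nat \<Rightarrow> 'a) measure \<Rightarrow> bool" where
  "product_type_measure \<mu> \<longleftrightarrow> (\<exists>m. prob_family m \<and> \<mu> = PiM UNIV m)"

text \<open>Intended for positive measurable \<open>\<phi>\<close>; a product potential is measurable, being a pointwise limit
  of functions of finitely many coordinates. Since the alphabet is countable, \<open>shift ` A\<close> is Borel
  for every Borel \<open>A\<close>: it is the union over \<open>a\<close> of the sets of all \<open>y\<close> such that \<open>a\<close> followed by \<open>y\<close>
  lies in \<open>A\<close>. So \<open>emeasure\<close> is never applied to a non-measurable set here.\<close>

definition conformal ::
  "((nat \<Rightarrow> 'a::{countable,discrete_topology}) \<Rightarrow> real) \<Rightarrow> (nat \<Rightarrow> 'a) measure \<Rightarrow> bool" where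
  "conformal \<phi> \<mu> \<longleftrightarrow>
     prob_space \<mu> \<and> sets \<mu> = sets borel \<and>
     (\<exists>c>0. \<forall>A\<in>sets borel. inj_on shift A \<longrightarrow>
        emeasure \<mu> (shift ` A) = ennreal c * (\<integral>\<^sup>+x\<in>A. ennreal (\<phi> x) \<partial>\<mu>))"

definition positive_on_open :: "'b::topological_space measure \<Rightarrow> bool" where
  "positive_on_open \<mu> \<longleftrightarrow> (\<forall>U. open U \<longrightarrow> U \<noteq> {} \<longrightarrow> 0 < emeasure \<mu> U)"

lemma open_cylinder: "open {x :: nat \<Rightarrow> 'a::discrete_topology. x i = a}"
proof -
  have "open ((\<lambda>x :: nat \<Rightarrow> 'a. x i) -` {a})"
    using continuous_on_open_vimage[OF open_UNIV, of "\<lambda>x :: nat \<Rightarrow> 'a. x i"] discrete_topology_class.open_discrete[of "{a}"]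
    by simp
  then show ?thesis
    by (simp add: vimage_def)
qed

text \<open>The product sigma-algebra carried by a product measure is the Borel sigma-algebra.\<close>

lemma sets_PiM_prob_family:
  fixes m :: "nat \<Rightarrow> 'a::{countable,discrete_topology} measure"
  assumes "prob_family m"
  shows "sets (PiM UNIV m) = sets borel"
proof
  have sm: "sets (m i) = UNIV" for i
    using assms by (simp add: prob_family_def)
  have sp: "space (m i) = UNIV" for i
    using sm[of i] sets.sets_into_space[of UNIV "m i"] by auto
  have spP: "space (PiM UNIV m) = UNIV"
    by (simp add: space_PiM sp)
  have id: "(\<lambda>x. x) \<in> measurable borel (PiM UNIV m)"
  proof (rule measurable_PiM_single')
    show "(\<lambda>x. x i) \<in> measurable borel (m i)" for i
    proof (rule measurableI)
      fix A assume "A \<in> sets (m i)"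
      have "(\<lambda>x :: nat \<Rightarrow> 'a. x i) -` A = (\<Union>a\<in>A. {x. x i = a})" by auto
      then have "open ((\<lambda>x :: nat \<Rightarrow> 'a. x i) -` A)"
        by (auto intro!: open_UN simp: open_cylinder)
      then show "(\<lambda>x :: nat \<Rightarrow> 'a. x i) -` A \<inter> space borel \<in> sets borel" by simp
    qed (simp add: sp)
  qed (simp add: sp)
  show "sets (PiM UNIV m) \<subseteq> sets borel"
  proof
    fix A assume "A \<in> sets (PiM UNIV m)"
    from measurable_sets[OF id this] show "A \<in> sets borel" by simp
  qed
next
  have sm: "sets (m i) = UNIV" for i
    using assms by (simp add: prob_family_def)
  have sp: "space (m i) = UNIV" for i
    using sm[of i] sets.sets_into_space[of UNIV "m i"] by auto
  have spP: "space (PiM UNIV m) = UNIV"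
    by (simp add: space_PiM sp)
  define Z where "Z w = {x :: nat \<Rightarrow> 'a. \<forall>i<length w. x i = w ! i}" for w
  have Zm: "Z w \<in> sets (PiM UNIV m)" for w
  proof -
    have "{x \<in> space (PiM UNIV m). \<forall>i\<in>{..<length w}. x i = w ! i} \<in> sets (PiM UNIV m)"
    proof (rule sets.sets_Collect_finite_All)
      fix i
      have "(\<lambda>x. x i) -` {w ! i} \<inter> space (PiM UNIV m) \<in> sets (PiM UNIV m)"
        by (rule measurable_sets[OF measurable_component_singleton]) (auto simp: sm)
      then show "{x \<in> space (PiM UNIV m). x i = w ! i} \<in> sets (PiM UNIV m)"
        by (simp add: vimage_def spP)
    next
      show "finite {..<length w}" by simp
    qed
    then show ?thesis by (simp add: Z_def spP lessThan_def)
  qed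
  have "U \<in> sets (PiM UNIV m)" if U: "open U" for U
  proof -
    have "\<exists>w. x \<in> Z w \<and> Z w \<subseteq> U" if "x \<in> U" for x
    proof -
      have "\<exists>Y. x \<in> Pi\<^sub>E UNIV Y \<and> (\<forall>i. openin euclidean (Y i)) \<and> finite {i. Y i \<noteq> topspace euclidean} \<and> Pi\<^sub>E UNIV Y \<subseteq> U"
        using product_topology_open_contains_basis[of "\<lambda>_. euclidean" "UNIV" U x] U that
        by (simp add: open_fun_def)
      then obtain Y where Y: "x \<in> Pi\<^sub>E UNIV Y" "finite {i. Y i \<noteq> UNIV}" "Pi\<^sub>E UNIV Y \<subseteq> U"
        by auto
      obtain n where n: "\<And>i. Y i \<noteq> UNIV \<Longrightarrow> i < n"
        using Y(2) finite_nat_set_iff_bounded by auto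
      have "Z (map x [0..<n]) \<subseteq> Pi\<^sub>E UNIV Y"
      proof
        fix y assume y: "y \<in> Z (map x [0..<n])"
        have "y i \<in> Y i" for i
          using y Y(1) n[of i] by (cases "i < n") (auto simp: Z_def PiE_iff)
        then show "y \<in> Pi\<^sub>E UNIV Y" by (simp add: PiE_iff)
      qed
      moreover have "x \<in> Z (map x [0..<n])" by (simp add: Z_def)
      ultimately show ?thesis using Y(3) by blast
    qed
    then have "U = (\<Union>w\<in>{w. Z w \<subseteq> U}. Z w)" by blast
    moreover have "(\<Union>w\<in>{w. Z w \<subseteq> U}. Z w) \<in> sets (PiM UNIV m)"
      by (rule sets.countable_UN'') (auto simp: Zm)
    ultimately show ?thesis by simp
  qed
  then show "sets borel \<subseteq> sets (PiM UNIV m)"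
    unfolding borel_def using sets.sigma_sets_subset[of "{S. open S}" "PiM UNIV m"] spP by auto
qed

text \<open>On an infinite alphabet a product potential with positive infimum need not have any conformal
  probability measure: the constant 1 has none. An existence theorem therefore has to ask for the
  convergence of the series \<open>\<Sum>b. 1 / gs 0 b\<close>, which is automatic on a finite alphabet.\<close>

lemma product_potential_const: "product_potential (\<lambda>_. 1) (\<lambda>_ _. 1)"
  by (simp add: product_potential_def has_product_form_def)

lemma not_conformal_const:
  fixes \<mu> :: "(nat \<Rightarrow> 'a::{countable,discrete_topology}) measure"
  assumes inf: "infinite (UNIV :: 'a set)"
  shows "\<not> conformal (\<lambda>_. 1) \<mu>"
proof
  assume conf: "conformal (\<lambda>_. 1) \<mu>"
  then obtain c where c: "c > 0" and P: "prob_space \<mu>" and S: "sets \<mu> = sets borel"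
    and eq: "\<And>A. A \<in> sets borel \<Longrightarrow> inj_on shift A \<Longrightarrow>
        emeasure \<mu> (shift ` A) = ennreal c * emeasure \<mu> A"
    unfolding conformal_def by auto
  interpret prob_space \<mu> by (fact P)
  define C where "C a = {x :: nat \<Rightarrow> 'a. x 0 = a}" for a
  have Cb: "C a \<in> sets borel" for a
    unfolding C_def by (rule borel_open) (rule open_cylinder)
  have C1: "1 = c * prob (C a)" for a
  proof -
    have "inj_on shift (C a)"
    proof (rule inj_onI, rule ext)
      fix x y n assume *: "x \<in> C a" "y \<in> C a" "shift x = shift y"
      show "x n = y n"
        using fun_cong[OF *(3)[unfolded shift_def], of "n - 1"] *(1,2)
        by (cases n) (simp_all add: C_def)
    qed
    moreover have "shift ` C a = UNIV"
    proof -
      have "y \<in> shift ` C a" for y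
        by (rule image_eqI[of _ _ "case_nat a y"]) (auto simp: shift_def C_def)
      then show ?thesis by auto
    qed
    ultimately have "emeasure \<mu> UNIV = ennreal c * emeasure \<mu> (C a)"
      using eq[OF Cb[of a]] by simp
    moreover have "space \<mu> = UNIV" using sets_eq_imp_space_eq[OF S] by simp
    ultimately have "1 = ennreal c * ennreal (prob (C a))"
      using emeasure_space_1 by (simp add: emeasure_eq_measure)
    then have "ennreal 1 = ennreal (c * prob (C a))"
      using c by (simp add: ennreal_mult)
    then show ?thesis using c by (subst (asm) ennreal_inj) auto
  qed
  obtain n :: nat where n: "c < real n" using reals_Archimedean2 by blast
  obtain F :: "'a set" where F: "finite F" "card F = n"
    using infinite_arbitrarily_large[OF inf] by blast
  have "prob (\<Union>a\<in>F. C a) = (\<Sum>a\<in>F. prob (C a))"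
  proof (rule finite_measure_finite_Union)
    show "finite F" by (rule F(1))
    show "C ` F \<subseteq> events"
      unfolding S using Cb by blast
    show "disjoint_family_on C F"
      unfolding disjoint_family_on_def C_def by blast
  qed
  also have "\<dots> = (\<Sum>a\<in>F. 1 / c)"
  proof (rule sum.cong[OF refl])
    show "prob (C a) = 1 / c" for a
      using C1[of a] c by (metis nonzero_mult_div_cancel_left less_irrefl)
  qed
  finally have "real n / c \<le> 1"
    using F(2) prob_le_1[of "\<Union>a\<in>F. C a"] by (simp del: prob_le_1)
  then show False using n c by (simp add: field_simps)
qed

end

theory Submission
  imports Defs
begin

text \<open>Testing conformality on the set of all \<open>x\<close> with prescribed \<open>x 0\<close> and \<open>x (Suc n) = b\<close> shows that
  the weight of \<open>b\<close> under the marginal \<open>m n\<close> is proportional to \<open>gs (Suc n) b\<close> times its weight under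
  \<open>m (Suc n)\<close>. Hence that weight times \<open>G n b = (\<Prod>i\<le>n. gs i b)\<close> does not depend on \<open>b\<close>, which
  determines \<open>m n\<close>.

  For existence, let \<open>m n\<close> have the weights \<open>1 / (G n b * z n)\<close>, where \<open>z n\<close> is the sum of the
  \<open>1 / G n b\<close>. The partial products of \<open>g\<close> itself need not be dominated, but those of \<open>1 / g\<close> are
  bounded on each branch \<open>x 0 = a\<close> when \<open>g\<close> has positive infimum. So one shows that the product
  measure restricted to the branch is the image under \<open>case_nat a\<close> of the density
  \<open>1 / (c * g (case_nat a y))\<close>, where \<open>c\<close> is the limit of the \<open>z n\<close>.\<close>

section \<open>Measurability and integration for product measures on a countable discrete
  alphabet\<close>

lemma prob_familyD:
  assumes "prob_family m"
  shows "prob_space (m n)" "sets (m n) = UNIV" "space (m n) = UNIV"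
proof -
  show "prob_space (m n)" and sets: "sets (m n) = UNIV"
    using assms by (auto simp: prob_family_def)
  then show "space (m n) = UNIV"
    by (metis UNIV_I sets.sets_into_space top.extremum_uniqueI)
qed

lemma space_PiM_prob_family: "prob_family m \<Longrightarrow> space (PiM UNIV m) = UNIV"
  by (simp add: space_PiM prob_familyD)

lemma measurable_prob_family: "prob_family m \<Longrightarrow> h \<in> measurable (m n) N \<longleftrightarrow> range h \<subseteq> space N"
  by (auto simp: measurable_def prob_familyD)

lemma prob_space_PiM_prob_family: "prob_family m \<Longrightarrow> prob_space (PiM UNIV m)"
  by (intro prob_space_PiM prob_familyD)

lemma measurable_coord:
  assumes "prob_family m" "range h \<subseteq> space N"
  shows "(\<lambda>x. h (x i)) \<in> measurable (PiM UNIV m) N"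
proof (rule measurable_compose[where f = "\<lambda>x. x i" and N = "m i"])
  show "(\<lambda>x. x i) \<in> measurable (PiM UNIV m) (m i)"
    by simp
  show "h \<in> measurable (m i) N"
    using assms by (simp add: measurable_prob_family)
qed

text \<open>Fubini: the product measure is the image of the product of \<open>m k\<close> with the
  measure on the other coordinates under \<open>X(k := t)\<close>. On the cylinder the inner
  integral is the constant \<open>I b\<close>, which comes out with the weight of
  \<open>b\<close>.\<close>

lemma nn_integral_PiM_coord:
  fixes m :: "nat \<Rightarrow> 'a::{countable,discrete_topology} measure"
  assumes m: "prob_family m" and F: "F \<in> borel_measurable (PiM UNIV m)"
  shows "(\<integral>\<^sup>+x\<in>{x. x k = b}. F x \<partial>PiM UNIV m) =
    emeasure (m k) {b} * (\<integral>\<^sup>+x. F (x(k := b)) \<partial>PiM UNIV m)"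
proof -
  let ?M = "PiM UNIV m" and ?N = "PiM (UNIV - {k}) m"
  note [measurable] = F
  have ins: "insert k (UNIV - {k}) = UNIV" by auto
  interpret K: prob_space "m k" by (rule prob_familyD[OF m])
  interpret N: prob_space ?N by (intro prob_space_PiM prob_familyD m)
  interpret P: pair_sigma_finite "m k" ?N by unfold_locales
  have [measurable]: "(\<lambda>(t, X). X(k := t)) \<in> measurable (m k \<Otimes>\<^sub>M ?N) ?M"
    using measurable_add_dim[of k "UNIV - {k}" m]
      measurable_compose[OF measurable_pair_swap' measurable_add_dim[of k "UNIV - {k}" m]]
    by (simp add: ins case_prod_beta)
  have eq: "?M = distr (m k \<Otimes>\<^sub>M ?N) ?M (\<lambda>(t, X). X(k := t))"
    using distr_pair_PiM_eq_PiM[of "UNIV - {k}" m k] prob_familyD(1)[OF m] by (simp add: ins)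
  have split: "(\<integral>\<^sup>+x. H x \<partial>?M) = (\<integral>\<^sup>+t. \<integral>\<^sup>+X. H (X(k := t)) \<partial>?N \<partial>m k)"
    if [measurable]: "H \<in> borel_measurable ?M" for H
    by (subst eq) (simp add: nn_integral_distr N.nn_integral_fst[symmetric] case_prod_beta)
  define I where "I t = (\<integral>\<^sup>+X. F (X(k := t)) \<partial>?N)" for t
  have ind[measurable]: "(\<lambda>x. indicator {x. x k = b} x :: ennreal) \<in> borel_measurable ?M"
    using measurable_coord[OF m, of "indicator {b} :: 'a \<Rightarrow> ennreal" borel k]
    by (simp add: indicator_def of_bool_def)
  have upd[measurable]: "(\<lambda>x. x(k := b)) \<in> measurable ?M ?M"
    by (rule measurable_PiM_single')
       (auto simp: space_PiM prob_familyD[OF m] prob_familyD(2)[OF m] intro!: measurable_component_singleton)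
  have "(\<integral>\<^sup>+x\<in>{x. x k = b}. F x \<partial>?M) = (\<integral>\<^sup>+t. \<integral>\<^sup>+X. F (X(k := t)) * indicator {x. x k = b} (X(k := t)) \<partial>?N \<partial>m k)"
    by (subst split) auto
  also have "\<dots> = (\<integral>\<^sup>+t. I b * indicator {b} t \<partial>m k)"
    by (intro nn_integral_cong) (auto simp: I_def indicator_def)
  also have "\<dots> = I b * emeasure (m k) {b}"
    by (simp add: nn_integral_cmult_indicator prob_familyD(2)[OF m])
  \<comment> \<open>The integrand on the right ignores coordinate \<open>k\<close>, so integrating
    over that coordinate only contributes the total mass 1 of \<open>m k\<close>.\<close>
  also have "I b = (\<integral>\<^sup>+x. F (x(k := b)) \<partial>?M)"
    by (subst split) (simp_all add: I_def K.emeasure_space_1)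
  finally show ?thesis by (simp add: mult.commute)
qed

text \<open>The integrand sees finitely many coordinates, so the integral can be moved to their
  finite product, where the factors are independent.\<close>

lemma nn_integral_PiM_prod:
  assumes m: "prob_family m"
  shows "(\<integral>\<^sup>+x. (\<Prod>i<N. h i (x i)) \<partial>PiM UNIV m) = (\<Prod>i<N. \<integral>\<^sup>+a. h i a \<partial>m i)"
proof -
  interpret product_prob_space m UNIV
    by (intro product_prob_spaceI prob_familyD m)
  have meas: "h i \<in> borel_measurable (m i)" for i
    by (simp add: measurable_prob_family[OF m])
  have "(\<Prod>i<N. \<integral>\<^sup>+a. h i a \<partial>m i) = (\<integral>\<^sup>+x. (\<Prod>i<N. h i (x i)) \<partial>PiM {..<N} m)"
    by (rule product_nn_integral_prod[symmetric]) (auto simp: meas)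
  also have "\<dots> = (\<integral>\<^sup>+x. (\<Prod>i<N. h i (x i)) \<partial>distr (PiM UNIV m) (PiM {..<N} m) (\<lambda>x. restrict x {..<N}))"
    by (subst distr_PiM_restrict_finite) auto
  also have "\<dots> = (\<integral>\<^sup>+x. (\<Prod>i<N. h i (x i)) \<partial>PiM UNIV m)"
    using meas by (subst nn_integral_distr) (auto intro!: borel_measurable_prod_ennreal measurable_restrict_subset
      intro: measurable_compose[OF measurable_component_singleton])
  finally show ?thesis by simp
qed

section \<open>Potentials of product type\<close>

text \<open>The logarithmic series at the two points differ in the term of index \<open>k\<close>
  only, so the ratio of the values of \<open>g\<close> is \<open>gs k a / gs k b\<close>.\<close>

lemma product_potential_update:
  assumes "product_potential g gs"
  shows "g (x(k := a)) * gs k b = g (x(k := b)) * gs k a"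
proof -
  have pos: "0 < g x" "0 < gs n c" for x n c
    using assms by (auto simp: product_potential_def)
  have s: "(\<lambda>n. ln (gs n (y n))) sums ln (g y)" for y
    using assms by (auto simp: product_potential_def has_product_form_def)
  have "(\<lambda>n. ln (gs n ((x(k := a)) n)) - ln (gs n ((x(k := b)) n))) sums (ln (g (x(k := a))) - ln (g (x(k := b))))"
    by (intro sums_diff s)
  also have "(\<lambda>n. ln (gs n ((x(k := a)) n)) - ln (gs n ((x(k := b)) n))) =
     (\<lambda>n. if n = k then ln (gs n a) - ln (gs n b) else 0)"
    by auto
  finally have "ln (g (x(k := a))) - ln (g (x(k := b))) = ln (gs k a) - ln (gs k b)"
    using sums_single[of k "\<lambda>n. ln (gs n a) - ln (gs n b)"] sums_unique2 by blast
  then have "ln (g (x(k := a)) * gs k b) = ln (g (x(k := b)) * gs k a)"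
    using pos by (simp add: ln_mult_pos)
  then show ?thesis
    using pos by (subst (asm) ln_inj_iff) auto
qed

lemma product_potential_LIMSEQ:
  assumes "product_potential g gs"
  shows "(\<lambda>N. \<Prod>i<N. gs i (x i)) \<longlonglongrightarrow> g x"
proof -
  have pos: "0 < g x" "0 < gs n c" for x n c
    using assms by (auto simp: product_potential_def)
  have "(\<lambda>N. exp (\<Sum>i<N. ln (gs i (x i)))) \<longlonglongrightarrow> exp (ln (g x))"
    using assms by (intro tendsto_intros) (auto simp: product_potential_def has_product_form_def sums_def)
  then show ?thesis using pos by (simp add: exp_sum)
qed

lemma product_potential_measurable:
  assumes "product_potential g gs" "prob_family m"
  shows "g \<in> borel_measurable (PiM UNIV m)"
  by (rule borel_measurable_LIMSEQ_real[OF product_potential_LIMSEQ[OF assms(1)]])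
     (auto intro!: borel_measurable_prod measurable_coord assms)

section \<open>Countable sums, coordinate cylinders and branches of the shift\<close>

text \<open>Links the sums in the formula for the marginals to integrals over counting measure, with
  which the proofs compute. Finiteness makes \<open>f\<close> absolutely summable, and both sides
  are then the supremum of the finite partial sums.\<close>

lemma infsum_ennreal_eq_nn_integral:
  fixes f :: "'a::countable \<Rightarrow> real"
  assumes "\<And>x. 0 \<le> f x" "(\<integral>\<^sup>+x. ennreal (f x) \<partial>count_space UNIV) < \<infinity>"
  shows "(\<Sum>\<^sub>\<infinity>x. ennreal (f x)) = (\<integral>\<^sup>+x. ennreal (f x) \<partial>count_space UNIV)"
proof -
  have abs: "Infinite_Set_Sum.abs_summable_on f UNIV"
    using assms by (auto simp: Infinite_Set_Sum.abs_summable_on_def integrable_iff_bounded)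
  then have abs': "Infinite_Sum.abs_summable_on f UNIV"
    by (simp only: abs_summable_equivalent)
  then have sm: "f summable_on UNIV"
    using abs_summable_summable by blast
  have "(\<integral>\<^sup>+x. ennreal (f x) \<partial>count_space UNIV) = ennreal (infsetsum f UNIV)"
    by (rule nn_integral_conv_infsetsum[OF abs]) (simp add: assms)
  also have "infsetsum f UNIV = infsum f UNIV"
    by (rule infsetsum_infsum[OF abs])
  also have "ennreal \<dots> = (SUP F\<in>{F. finite F \<and> F \<subseteq> UNIV}. ennreal (sum f F))"
    by (rule infsum_nonneg_is_SUPREMUM_ennreal[OF sm]) (simp add: assms)
  also have "\<dots> = (\<Sum>\<^sub>\<infinity>x. ennreal (f x))"
    by (subst nonneg_infsum_complete) (simp_all add: assms)
  finally show ?thesis ..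
qed

lemma sets_coord:
  assumes "prob_family m"
  shows "{x. x i = a} \<in> sets (PiM UNIV m)"
proof -
  have "(\<lambda>x. x i) -` {a} \<inter> space (PiM UNIV m) \<in> sets (PiM UNIV m)"
    using prob_familyD(2)[OF assms] by (intro measurable_sets[OF measurable_component_singleton]) auto
  then show ?thesis
    by (simp add: vimage_def space_PiM_prob_family[OF assms])
qed

lemma emeasure_PiM_coord:
  fixes m :: "nat \<Rightarrow> 'a::{countable,discrete_topology} measure"
  assumes m: "prob_family m"
  shows "emeasure (PiM UNIV m) {x. x i = a} = emeasure (m i) {a}"
  using nn_integral_PiM_coord[OF m, of "\<lambda>_. 1" i a] sets_coord[OF m, of i a]
    prob_space.emeasure_space_1[OF prob_space_PiM_prob_family[OF m]] by simp

lemma inj_on_shift: "(\<And>x. x \<in> A \<Longrightarrow> x 0 = a) \<Longrightarrow> inj_on shift A"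
proof (rule inj_onI, rule ext)
  fix x y n assume "\<And>x. x \<in> A \<Longrightarrow> x 0 = a" "x \<in> A" "y \<in> A" "shift x = shift y"
  then show "x n = y n"
    by (cases n) (auto simp: shift_def dest: fun_cong)
qed

lemma shift_case_nat [simp]: "shift (case_nat a y) = y"
  by (simp add: shift_def)

lemma case_nat_shift: "x 0 = a \<Longrightarrow> case_nat a (shift x) = x"
  by (auto simp: shift_def fun_eq_iff split: nat.split)

text \<open>On one branch the shift is inverted by \<open>case_nat a\<close>. Writing the image as a
  preimage makes its measurability immediate.\<close>

lemma image_shift:
  assumes "\<And>x. x \<in> A \<Longrightarrow> x 0 = a"
  shows "shift ` A = {y. case_nat a y \<in> A}"
  using assms by (force simp: case_nat_shift intro: image_eqI[where x = "case_nat a _"])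

section \<open>The marginals of a conformal product measure\<close>

text \<open>Conformality is tested on the sets where \<open>x k = b\<close> inside a set
  \<open>S\<close> that ignores coordinate \<open>k\<close>. Integrating out that coordinate yields
  the weight of \<open>b\<close>, the product form of \<open>g\<close> yields \<open>gs k b\<close>,
  and what remains is the same for every \<open>b\<close>.\<close>

lemma conformal_coord_ratio:
  fixes g :: "(nat \<Rightarrow> 'a::{countable,discrete_topology}) \<Rightarrow> real"
  assumes g: "product_potential g gs" and m: "prob_family m"
    and c: "c > 0" and conf: "\<And>A. A \<in> sets borel \<Longrightarrow> inj_on shift A \<Longrightarrow>
      emeasure (PiM UNIV m) (shift ` A) = ennreal c * (\<integral>\<^sup>+x\<in>A. ennreal (g x) \<partial>PiM UNIV m)"
    and S: "S \<in> sets borel" "\<And>x b. x(k := b) \<in> S \<longleftrightarrow> x \<in> S"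
    and inj: "\<And>b. inj_on shift ({x. x k = b} \<inter> S)"
    and r: "\<And>b. 0 < r b" "\<And>b. emeasure (PiM UNIV m) (shift ` ({x. x k = b} \<inter> S)) = ennreal (r b)"
  obtains K where "K > 0" "\<And>b. r b = K * (gs k b * measure (m k) {b})"
proof -
  let ?M = "PiM UNIV m"
  have sets: "sets ?M = sets borel" by (rule sets_PiM_prob_family[OF m])
  interpret prob_space "m k" by (rule prob_familyD[OF m])
  have pos: "0 < g x" "0 < gs n b" for x n b
    using g by (auto simp: product_potential_def)
  have [measurable]: "g \<in> borel_measurable ?M" "S \<in> sets ?M"
    using product_potential_measurable[OF g m] S sets by auto
  \<comment> \<open>An arbitrary reference letter; \<open>L\<close> is the integral left once the
    factor \<open>gs k b\<close> has been divided out.\<close>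
  define b\<^sub>0 where "b\<^sub>0 = (undefined :: 'a)"
  define L where "L = (\<integral>\<^sup>+x. ennreal (g (x(k := b\<^sub>0)) / gs k b\<^sub>0) * indicator S x \<partial>?M)"
  have upd: "g (x(k := b)) = gs k b * (g (x(k := b\<^sub>0)) / gs k b\<^sub>0)" for x b
    using product_potential_update[OF g, of x k b b\<^sub>0] pos(2)[of k b\<^sub>0] by (simp add: field_simps)
  have [measurable]: "(\<lambda>x. x(k := b)) \<in> measurable ?M ?M" for b
    by (rule measurable_PiM_single')
       (auto simp: space_PiM prob_familyD[OF m] intro!: measurable_component_singleton)
  have L: "ennreal (r b) = ennreal (c * (gs k b * measure (m k) {b})) * L" for b
  proof -
    have "ennreal (r b) = ennreal c * (\<integral>\<^sup>+x\<in>{x. x k = b} \<inter> S. ennreal (g x) \<partial>?M)"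
      using sets_coord[OF m, of k b] S inj unfolding sets by (subst r(2)[symmetric], subst conf) auto
    also have "(\<integral>\<^sup>+x\<in>{x. x k = b} \<inter> S. ennreal (g x) \<partial>?M) =
        (\<integral>\<^sup>+x\<in>{x. x k = b}. (ennreal (g x) * indicator S x) \<partial>?M)"
      by (intro nn_integral_cong) (auto simp: indicator_def)
    also have "\<dots> = emeasure (m k) {b} * (\<integral>\<^sup>+x. ennreal (g (x(k := b))) * indicator S (x(k := b)) \<partial>?M)"
      by (rule nn_integral_PiM_coord[OF m]) measurable
    also have "(\<integral>\<^sup>+x. ennreal (g (x(k := b))) * indicator S (x(k := b)) \<partial>?M) =
        (\<integral>\<^sup>+x. ennreal (gs k b) * (ennreal (g (x(k := b\<^sub>0)) / gs k b\<^sub>0) * indicator S x) \<partial>?M)"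
    proof (rule nn_integral_cong)
      fix x
      have "ennreal (g (x(k := b))) = ennreal (gs k b) * ennreal (g (x(k := b\<^sub>0)) / gs k b\<^sub>0)"
        using pos unfolding upd[of x b] by (intro ennreal_mult) (auto simp: less_imp_le)
      then show "ennreal (g (x(k := b))) * indicator S (x(k := b)) =
          ennreal (gs k b) * (ennreal (g (x(k := b\<^sub>0)) / gs k b\<^sub>0) * indicator S x)"
        by (simp add: indicator_def S(2) mult.assoc)
    qed
    also have "\<dots> = ennreal (gs k b) * L"
      unfolding L_def by (rule nn_integral_cmult) measurable
    finally show ?thesis
      using c pos(2)[of k b] by (simp add: emeasure_eq_measure ennreal_mult mult_ac)
  qed
  \<comment> \<open>Otherwise the right-hand side of the identity for \<open>L\<close> would be 0 or
    infinite, whereas \<open>r\<close> is positive and finite.\<close>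
  have "L \<noteq> 0" "L \<noteq> \<infinity>"
    using L[of b\<^sub>0] r(1)[of b\<^sub>0] by (auto simp: ennreal_mult_top split: if_splits)
  then obtain l where l: "L = ennreal l" "l > 0"
    by (cases L) (auto simp: less_le)
  show ?thesis
  proof (rule that[of "c * l"])
    show "c * l > 0" using c l by simp
    fix b
    show "r b = c * l * (gs k b * measure (m k) {b})"
      using L[of b] l c r(1)[of b] pos(2)[of k b]
      by (simp add: ennreal_mult[symmetric] mult_ac)
  qed
qed

lemma conformal_product_marginals:
  fixes g :: "(nat \<Rightarrow> 'a::{countable,discrete_topology}) \<Rightarrow> real"
  assumes g: "product_potential g gs" and m: "prob_family m"
    and conf: "conformal g (PiM UNIV m)" and op: "positive_on_open (PiM UNIV m)"
  shows "emeasure (m n) {a} = inverse (\<Sum>\<^sub>\<infinity>b. ennreal (\<Prod>i\<le>n. gs i a / gs i b))"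
proof -
  let ?M = "PiM UNIV m"
  interpret m: prob_space "m i" for i by (rule prob_familyD[OF m])
  have sets: "sets ?M = sets borel" by (rule sets_PiM_prob_family[OF m])
  have pos: "0 < gs n b" for n b
    using g by (auto simp: product_potential_def)
  obtain c where c: "c > 0" and eq: "\<And>A. A \<in> sets borel \<Longrightarrow> inj_on shift A \<Longrightarrow>
      emeasure ?M (shift ` A) = ennreal c * (\<integral>\<^sup>+x\<in>A. ennreal (g x) \<partial>?M)"
    using conf by (auto simp: conformal_def)
  define p where "p n a = measure (m n) {a}" for n a
  define G where "G n a = (\<Prod>i\<le>n. gs i a)" for n a
  have p_pos: "p n a > 0" for n a
    using op open_cylinder[of n a] emeasure_PiM_coord[OF m, of n a]
    by (auto simp: positive_on_open_def p_def m.emeasure_eq_measure)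
  have G_pos: "G n a > 0" for n a
    by (simp add: G_def prod_pos pos)
  \<comment> \<open>The key invariant: \<open>p n b\<close> is inversely proportional to
    \<open>G n b\<close>. The constant may depend on \<open>n\<close>.\<close>
  have "\<exists>K>0. \<forall>b. G n b * p n b = K" for n
  proof (induction n)
    case 0
    \<comment> \<open>Each cylinder at coordinate 0 is mapped onto the whole space, so every image
      has measure 1.\<close>
    obtain K where K: "K > 0" "\<And>b. 1 = K * (gs 0 b * measure (m 0) {b})"
    proof (rule conformal_coord_ratio[OF g m c eq, of UNIV 0 "\<lambda>_. 1"])
      show "inj_on shift ({x. x 0 = b} \<inter> UNIV)" for b
        by (rule inj_on_shift[of _ b]) auto
      show "emeasure ?M (shift ` ({x. x 0 = b} \<inter> UNIV)) = ennreal 1" for b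
        using prob_space.emeasure_space_1[OF prob_space_PiM_prob_family[OF m]]
        by (subst image_shift[of _ b]) (auto simp: space_PiM_prob_family[OF m])
    qed auto
    then have "\<forall>b. G 0 b * p 0 b = 1 / K"
      by (simp add: G_def p_def field_simps)
    then show ?case using K(1) by (intro exI[of _ "1 / K"]) simp
  next
    case (Suc n)
    then obtain K where K: "K > 0" "\<And>b. G n b * p n b = K" by blast
    define a\<^sub>0 where "a\<^sub>0 = (undefined :: 'a)"
    \<comment> \<open>Intersecting with the branch of \<open>a\<^sub>0\<close> makes the shift
      injective. The image is the full cylinder at coordinate \<open>n\<close>, of measure
      \<open>p n b\<close>.\<close>
    obtain L where L: "L > 0" "\<And>b. p n b = L * (gs (Suc n) b * measure (m (Suc n)) {b})"
    proof (rule conformal_coord_ratio[OF g m c eq, of "{x. x 0 = a\<^sub>0}" "Suc n" "p n"])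
      show "inj_on shift ({x. x (Suc n) = b} \<inter> {x. x 0 = a\<^sub>0})" for b
        by (rule inj_on_shift[of _ a\<^sub>0]) auto
      show "emeasure ?M (shift ` ({x. x (Suc n) = b} \<inter> {x. x 0 = a\<^sub>0})) = ennreal (p n b)" for b
        using emeasure_PiM_coord[OF m, of n b]
        by (subst image_shift[of _ a\<^sub>0]) (auto simp: p_def m.emeasure_eq_measure)
      show "{x :: nat \<Rightarrow> 'a. x 0 = a\<^sub>0} \<in> sets borel"
        by (intro borel_open open_cylinder)
    qed (auto simp: p_pos)
    have "G (Suc n) b * p (Suc n) b = K / L" for b
      using K(2)[of b] L(1) L(2)[of b] by (simp add: G_def p_def field_simps)
    then show ?case using K(1) L(1) by (intro exI[of _ "K / L"]) simp
  qed
  then obtain K where K: "K > 0" "\<And>b. G n b * p n b = K" by blast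
  have ratio: "p n a * (\<Prod>i\<le>n. gs i a / gs i b) = p n b" for b
  proof -
    have "p n b = K / G n b"
      using K(2)[of b] G_pos[of n b] by (metis less_irrefl nonzero_mult_div_cancel_left)
    then show ?thesis
      using K(2)[of a] by (simp add: G_def prod_dividef mult.commute)
  qed
  have r_nonneg: "0 \<le> (\<Prod>i\<le>n. gs i a / gs i b)" for b
    by (intro prod_nonneg) (simp add: pos less_imp_le)
  let ?S = "\<integral>\<^sup>+b. ennreal (\<Prod>i\<le>n. gs i a / gs i b) \<partial>count_space UNIV"
  \<comment> \<open>Summing \<open>ratio\<close> over all letters \<open>b\<close> and using that
    the weights sum to 1 gives \<open>p n a\<close> as the reciprocal of the sum.\<close>
  have "ennreal (p n a) * ?S = (\<integral>\<^sup>+b. ennreal (p n b) \<partial>count_space UNIV)"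
    using p_pos[of n a] r_nonneg
    by (subst nn_integral_cmult[symmetric]) (auto simp: ennreal_mult[symmetric] ratio)
  also have "\<dots> = (\<integral>\<^sup>+b. emeasure (m n) {b} \<partial>count_space UNIV)"
    by (simp add: p_def m.emeasure_eq_measure)
  also have "\<dots> = emeasure (m n) UNIV"
    by (rule emeasure_countable_singleton[symmetric]) (auto simp: prob_familyD(2)[OF m])
  finally have S: "ennreal (p n a) * ?S = 1"
    using m.emeasure_space_1[of n] by (simp add: prob_familyD(3)[OF m])
  have fin: "?S < \<infinity>"
    using S p_pos[of n a] by (auto simp: ennreal_mult_top less_top[symmetric])
  have "?S = ennreal (1 / p n a)"
  proof -
    obtain s where s: "?S = ennreal s" "s \<ge> 0" using fin by (cases ?S) auto
    then have "p n a * s = 1"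
      using S p_pos[of n a] by (simp add: ennreal_mult[symmetric])
    then show ?thesis using s p_pos[of n a] by (simp add: field_simps)
  qed
  then show ?thesis
    using infsum_ennreal_eq_nn_integral[OF r_nonneg fin] p_pos[of n a]
    by (simp add: inverse_ennreal m.emeasure_eq_measure p_def)
qed

section \<open>Positivity on open sets, lower bounds for the potential, and a criterion for
  conformality\<close>

text \<open>A nonempty open set contains a cylinder fixing finitely many coordinates, whose measure
  is a finite product of positive weights.\<close>

lemma positive_on_open_PiM:
  fixes m :: "nat \<Rightarrow> 'a::{countable,discrete_topology} measure"
  assumes m: "prob_family m" and pos: "\<And>n a. 0 < emeasure (m n) {a}"
  shows "positive_on_open (PiM UNIV m)"
  unfolding positive_on_open_def
proof (intro allI impI)
  fix U :: "(nat \<Rightarrow> 'a) set"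
  assume U: "open U" "U \<noteq> {}"
  then obtain x where "x \<in> U" by blast
  then obtain Y where Y: "x \<in> Pi\<^sub>E UNIV Y" "finite {i. Y i \<noteq> UNIV}" "Pi\<^sub>E UNIV Y \<subseteq> U"
    using product_topology_open_contains_basis[of "\<lambda>_. euclidean" "UNIV" U x] U
    by (auto simp: open_fun_def)
  let ?J = "{i. Y i \<noteq> UNIV}"
  let ?E = "prod_emb UNIV m ?J (Pi\<^sub>E ?J (\<lambda>i. {x i}))"
  have "?E \<subseteq> Pi\<^sub>E UNIV Y"
    using Y(1) by (auto simp: prod_emb_iff PiE_iff restrict_def) (metis UNIV_I singletonD)
  moreover have "0 < emeasure (PiM UNIV m) ?E"
    using Y(2) by (subst emeasure_PiM_emb)
      (auto simp: prob_familyD[OF m] prob_familyD(2)[OF m] zero_less_iff_neq_zero pos[THEN less_imp_neq, symmetric])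
  moreover have "U \<in> sets (PiM UNIV m)"
    using U by (simp add: sets_PiM_prob_family[OF m])
  ultimately show "0 < emeasure (PiM UNIV m) U"
    using emeasure_mono[of ?E U "PiM UNIV m"] Y(3) by (auto intro: less_le_trans)
qed

text \<open>Choosing each \<open>z n\<close> to be a near-minimiser of \<open>gs n\<close>, the convergence of the series at the
  single point \<open>z\<close> bounds all partial products from below.\<close>

lemma product_potential_tail_bound:
  fixes g :: "(nat \<Rightarrow> 'a) \<Rightarrow> real"
  assumes g: "product_potential g gs" and inf: "(INF x. g x) > 0"
  obtains C where "C > 0" "\<And>x N. C \<le> (\<Prod>i<N. gs (Suc i) (x i))"
proof -
  have pos: "0 < g x" "0 < gs n b" for x n b
    using g by (auto simp: product_potential_def)
  define c where "c = (INF x. g x)"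
  have c: "c > 0" using inf by (simp add: c_def)
  have c_le: "c \<le> g x" for x
    unfolding c_def by (rule cINF_lower) (auto intro!: bdd_belowI[of _ 0] simp: pos less_imp_le)
  have "\<exists>z. \<forall>a. ln (gs n z) \<le> ln (gs n a) + (1/2)^n" for n
  proof -
    define u where "u = (undefined :: 'a)"
    \<comment> \<open>Changing coordinate \<open>n\<close> of a constant sequence from
      \<open>u\<close> to \<open>a\<close> turns the lower bound on \<open>g\<close> into one on
      \<open>gs n\<close>, uniform in \<open>a\<close>.\<close>
    have "c * gs n u / g (\<lambda>_. u) \<le> gs n a" for a
    proof -
      have "g (\<lambda>_. u) * gs n a = g ((\<lambda>_. u)(n := a)) * gs n u"
        using product_potential_update[OF g, of "\<lambda>_. u" n u a] by (simp only: fun_upd_idem)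
      also have "\<dots> \<ge> c * gs n u"
        using c_le pos by (intro mult_right_mono) (auto simp: less_imp_le)
      finally show ?thesis using pos by (simp add: field_simps)
    qed
    then have "ln (c * gs n u / g (\<lambda>_. u)) \<le> ln (gs n a)" for a
      using c pos by (subst ln_le_cancel_iff) auto
    then have bdd: "bdd_below (range (\<lambda>a. ln (gs n a)))"
      by (intro bdd_belowI2)
    \<comment> \<open>The infimum over an infinite alphabet may not be attained; the slack
      \<open>(1/2)^n\<close> keeps the total loss finite.\<close>
    have "(INF a. ln (gs n a)) < (INF a. ln (gs n a)) + (1/2)^n"
      by simp
    then have "\<exists>z\<in>UNIV. ln (gs n z) < (INF a. ln (gs n a)) + (1/2)^n"
      by (simp only: cINF_less_iff[OF UNIV_not_empty bdd])
    then obtain z where z: "ln (gs n z) < (INF a. ln (gs n a)) + (1/2)^n"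
      by blast
    have "ln (gs n z) \<le> ln (gs n a) + (1/2)^n" for a
      using z cINF_lower[OF bdd, of a] by simp
    then show ?thesis by blast
  qed
  then obtain z where z: "\<And>n a. ln (gs n (z n)) \<le> ln (gs n a) + (1/2)^n"
    by metis
  have "(\<lambda>N. \<Sum>i<N. ln (gs i (z i))) \<longlonglongrightarrow> ln (g z)"
    using g by (simp add: product_potential_def has_product_form_def sums_def)
  then have "Bseq (\<lambda>N. \<Sum>i<N. ln (gs i (z i)))"
    by (intro convergent_imp_Bseq) (auto simp: convergent_def)
  then obtain K where K: "\<And>N. \<bar>\<Sum>i<N. ln (gs i (z i))\<bar> \<le> K"
    by (auto simp: Bseq_def)
  \<comment> \<open>\<open>- K\<close> bounds the partial sums at \<open>z\<close> from below, the
    next term removes coordinate 0, and 1 bounds the total slack from index 1 on.\<close>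
  define D where "D = - K - ln (gs 0 (z 0)) - 1"
  show ?thesis
  proof (rule that[of "exp D"])
    fix x :: "nat \<Rightarrow> 'a" and N
    have half: "(\<Sum>i<N. (1/2)^Suc i :: real) = 1 - (1/2)^N"
      by (induction N) auto
    have "D \<le> (\<Sum>i<Suc N. ln (gs i (z i))) - ln (gs 0 (z 0)) - (\<Sum>i<N. (1/2)^Suc i)"
      using K[of "Suc N"] zero_le_power[of "1/2 :: real" N] unfolding half D_def by linarith
    also have "\<dots> = (\<Sum>i<N. ln (gs (Suc i) (z (Suc i))) - (1/2)^Suc i)"
      by (subst sum.lessThan_Suc_shift) (simp add: sum_subtractf)
    also have "\<dots> \<le> (\<Sum>i<N. ln (gs (Suc i) (x i)))"
      using z by (intro sum_mono) (simp add: diff_le_eq del: power_Suc)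
    finally have "exp D \<le> exp (\<Sum>i<N. ln (gs (Suc i) (x i)))" by simp
    also have "\<dots> = (\<Prod>i<N. gs (Suc i) (x i))"
      using pos by (simp add: exp_sum)
    finally show "exp D \<le> (\<Prod>i<N. gs (Suc i) (x i))" .
  qed simp
qed

lemma measurable_case_nat_PiM:
  assumes m: "prob_family m"
  shows "case_nat a \<in> measurable (PiM UNIV m) (PiM UNIV m)"
proof (rule measurable_PiM_single')
  fix i :: nat
  show "(\<lambda>x. case_nat a x i) \<in> measurable (PiM UNIV m) (m i)"
    by (cases i) (auto simp: prob_familyD[OF m] intro: measurable_coord[OF m, of "\<lambda>x. x", simplified])
qed (auto simp: space_PiM prob_familyD[OF m])

text \<open>It suffices to test conformality on the branches \<open>x 0 = a\<close>, where the shift inverts \<open>case_nat a\<close>.\<close>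

lemma conformalI:
  fixes m :: "nat \<Rightarrow> 'a::{countable,discrete_topology} measure"
  assumes m: "prob_family m" and g: "product_potential g gs" and c: "c > 0"
    and branch: "\<And>a. density (PiM UNIV m) (indicator {x. x 0 = a}) =
      distr (density (PiM UNIV m) (\<lambda>y. ennreal (1 / (c * g (case_nat a y))))) (PiM UNIV m) (case_nat a)"
  shows "conformal g (PiM UNIV m)"
proof -
  let ?M = "PiM UNIV m"
  have pos: "0 < g x" for x
    using g by (auto simp: product_potential_def)
  have sets: "sets ?M = sets borel" by (rule sets_PiM_prob_family[OF m])
  note [measurable] = product_potential_measurable[OF g m] measurable_case_nat_PiM[OF m] sets_coord[OF m]
  \<comment> \<open>After the change of variables in \<open>branch\<close> the factor
    \<open>g\<close> cancels against \<open>1 / (c * g)\<close>, leaving the measure of the shifted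
    set.\<close>
  have branch': "emeasure ?M (shift ` (A \<inter> {x. x 0 = a})) =
      ennreal c * emeasure (density ?M g) (A \<inter> {x. x 0 = a})"
    if [measurable]: "A \<in> sets ?M" for A a
  proof -
    let ?B = "{y. case_nat a y \<in> A}"
    have B: "?B \<in> sets ?M"
      using measurable_sets[OF measurable_case_nat_PiM[OF m] that]
      by (simp add: vimage_def space_PiM_prob_family[OF m])
    have "emeasure (density ?M g) (A \<inter> {x. x 0 = a}) =
        (\<integral>\<^sup>+x. ennreal (g x) * indicator A x \<partial>density ?M (indicator {x. x 0 = a}))"
      by (subst emeasure_density, measurable, subst nn_integral_density)
         (auto intro!: nn_integral_cong simp: indicator_def)
    also have "\<dots> = (\<integral>\<^sup>+y. ennreal (1 / (c * g (case_nat a y))) *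
        (ennreal (g (case_nat a y)) * indicator A (case_nat a y)) \<partial>?M)"
      by (subst branch, subst nn_integral_distr, measurable, subst nn_integral_density) measurable
    also have "\<dots> = (\<integral>\<^sup>+y. ennreal (1 / c) * indicator ?B y \<partial>?M)"
    proof (rule nn_integral_cong)
      fix y
      have "ennreal (1 / (c * g (case_nat a y))) * ennreal (g (case_nat a y)) = ennreal (1 / c)"
        using pos[of "case_nat a y"] c by (simp add: ennreal_mult[symmetric])
      then show "ennreal (1 / (c * g (case_nat a y))) *
          (ennreal (g (case_nat a y)) * indicator A (case_nat a y)) = ennreal (1 / c) * indicator ?B y"
        by (simp add: mult.assoc[symmetric] indicator_def)
    qed
    also have "\<dots> = ennreal (1 / c) * emeasure ?M ?B"
      using B by (simp add: nn_integral_cmult_indicator)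
    finally have "ennreal c * emeasure (density ?M g) (A \<inter> {x. x 0 = a}) =
        ennreal c * ennreal (1 / c) * emeasure ?M ?B"
      by (simp add: mult.assoc)
    also have "ennreal c * ennreal (1 / c) = 1"
      using c by (simp add: ennreal_mult[symmetric])
    also have "?B = shift ` (A \<inter> {x. x 0 = a})"
      by (subst image_shift[of _ a]) auto
    finally show ?thesis by simp
  qed
  have "emeasure ?M (shift ` A) = ennreal c * (\<integral>\<^sup>+x\<in>A. ennreal (g x) \<partial>?M)"
    if "A \<in> sets borel" and inj: "inj_on shift A" for A
  proof -
    have A[measurable]: "A \<in> sets ?M" using that sets by simp
    let ?A = "\<lambda>a. A \<inter> {x. x 0 = a}"
    have sh: "shift ` ?A a \<in> sets ?M" for a
      using measurable_sets[OF measurable_case_nat_PiM[OF m, of a], of "?A a"]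
      by (subst image_shift[of _ a]) (auto simp: vimage_def space_PiM_prob_family[OF m])
    have "emeasure ?M (shift ` A) = emeasure ?M (\<Union>a. shift ` ?A a)"
      by (rule arg_cong[where f = "emeasure ?M"]) auto
    \<comment> \<open>Injectivity of the shift on \<open>A\<close> is what makes the images of the
      different branches disjoint.\<close>
    also have "\<dots> = (\<integral>\<^sup>+a. emeasure ?M (shift ` ?A a) \<partial>count_space UNIV)"
      using inj sh by (intro emeasure_UN_countable) (auto simp: disjoint_family_on_def inj_on_def)
    also have "\<dots> = ennreal c * (\<integral>\<^sup>+a. emeasure (density ?M g) (?A a) \<partial>count_space UNIV)"
      by (simp add: branch'[OF A] nn_integral_cmult)
    also have "(\<integral>\<^sup>+a. emeasure (density ?M g) (?A a) \<partial>count_space UNIV) = emeasure (density ?M g) (\<Union>a. ?A a)"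
      by (intro emeasure_UN_countable[symmetric]) (auto simp: disjoint_family_on_def)
    also have "(\<Union>a. ?A a) = A" by auto
    finally show ?thesis by (simp add: emeasure_density)
  qed
  then show ?thesis
    using c prob_space_PiM_prob_family[OF m] sets by (auto simp: conformal_def)
qed

section \<open>Construction of a conformal product measure\<close>

text \<open>The tail bound gives \<open>gs 0 b * C \<le> G n b\<close>, so summability of
  \<open>1 / gs 0 b\<close> makes all normalising sums finite and dominates their passage to the
  limit. The branch identity for \<open>conformalI\<close> is then checked on cylinders by
  truncating \<open>g\<close> and letting the truncation grow.\<close>

lemma conformal_product_exists:
  fixes g :: "(nat \<Rightarrow> 'a::{countable,discrete_topology}) \<Rightarrow> real"
  assumes g: "product_potential g gs" and inf: "(INF x. g x) > 0"
    and summable: "(\<lambda>b. 1 / gs 0 b) summable_on UNIV"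
  shows "\<exists>m. prob_family m \<and> conformal g (PiM UNIV m) \<and> positive_on_open (PiM UNIV m)"
proof -
  have pos: "0 < g x" "0 < gs n b" for x n b
    using g by (auto simp: product_potential_def)
  obtain C where C: "C > 0" "\<And>x N. C \<le> (\<Prod>i<N. gs (Suc i) (x i))"
    using product_potential_tail_bound[OF g inf] by blast
  define G where "G n b = (\<Prod>i\<le>n. gs i b)" for n b
  have G_pos: "G n b > 0" for n b
    by (simp add: G_def prod_pos pos)
  have G_Suc: "G (Suc n) b = G n b * gs (Suc n) b" for n b
    by (simp add: G_def)
  have G_lim: "(\<lambda>n. G n b) \<longlonglongrightarrow> g (\<lambda>_. b)" for b
    using product_potential_LIMSEQ[OF g, of "\<lambda>_. b", THEN LIMSEQ_Suc]
    by (simp add: G_def lessThan_Suc_atMost)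
  have G_ge: "gs 0 b * C \<le> G n b" for n b
    using C(2)[of "\<lambda>_. b" n] pos(2)[of 0 b]
    by (simp add: G_def lessThan_Suc_atMost[symmetric] prod.lessThan_Suc_shift del: prod.lessThan_Suc)
  have fin0: "(\<integral>\<^sup>+b. ennreal (1 / (gs 0 b * C)) \<partial>count_space UNIV) < \<infinity>"
  proof -
    have "Infinite_Sum.abs_summable_on (\<lambda>b. 1 / gs 0 b) UNIV"
      using summable pos(2)[of 0] by (simp add: less_imp_le)
    then have "Infinite_Set_Sum.abs_summable_on (\<lambda>b. 1 / gs 0 b) UNIV"
      by (simp only: abs_summable_equivalent)
    then have "(\<integral>\<^sup>+b. ennreal (1 / gs 0 b) \<partial>count_space UNIV) < \<infinity>"
      using pos(2)[of 0]
      by (simp add: Infinite_Set_Sum.abs_summable_on_def integrable_iff_bounded less_imp_le)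
    moreover have "(\<integral>\<^sup>+b. ennreal (1 / (gs 0 b * C)) \<partial>count_space UNIV) =
        ennreal (1 / C) * (\<integral>\<^sup>+b. ennreal (1 / gs 0 b) \<partial>count_space UNIV)"
      using C(1) pos(2)[of 0]
      by (subst nn_integral_cmult[symmetric])
         (auto intro!: nn_integral_cong simp: ennreal_mult[symmetric] less_imp_le mult.commute)
    ultimately show ?thesis by (simp add: ennreal_mult_less_top)
  qed
  define Z where "Z n = (\<integral>\<^sup>+b. ennreal (1 / G n b) \<partial>count_space UNIV)" for n
  \<comment> \<open>\<open>G n b\<close> converges to the value of \<open>g\<close> at the constant
    sequence \<open>b\<close>, so this is the expected limit of \<open>Z\<close>; it becomes the
    conformality constant \<open>c\<close>.\<close>
  define Zinf where "Zinf = (\<integral>\<^sup>+b. ennreal (1 / g (\<lambda>_. b)) \<partial>count_space UNIV)"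
  have Z_lim: "Z \<longlonglongrightarrow> Zinf"
    unfolding Z_def Zinf_def
  proof (rule nn_integral_dominated_convergence[OF _ _ _ _ fin0])
    fix n
    have "ennreal (1 / G n b) \<le> ennreal (1 / (gs 0 b * C))" for b
      using G_ge[of b n] C(1) pos(2)[of 0 b] by (intro ennreal_leI divide_left_mono) (auto simp: G_pos)
    then show "AE b in count_space UNIV. ennreal (1 / G n b) \<le> ennreal (1 / (gs 0 b * C))"
      by simp
    show "AE b in count_space UNIV. (\<lambda>n. ennreal (1 / G n b)) \<longlonglongrightarrow> ennreal (1 / g (\<lambda>_. b))"
      using pos(1) by (intro AE_I2 tendsto_intros G_lim) (auto simp: less_imp_neq[symmetric])
  qed auto
  have int_pos: "0 < (\<integral>\<^sup>+b. ennreal (f b) \<partial>count_space UNIV)" if "\<And>b. 0 < f b" for f :: "'a \<Rightarrow> real"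
  proof -
    have "ennreal (f undefined) \<le> (\<integral>\<^sup>+b. ennreal (f b) \<partial>count_space UNIV)"
      by (rule nn_integral_ge_point) simp
    then show ?thesis using that[of undefined] by (metis ennreal_less_zero_iff less_le_trans)
  qed
  have le: "(\<integral>\<^sup>+b. ennreal (1 / f b) \<partial>count_space UNIV) < \<infinity>" if "\<And>b. gs 0 b * C \<le> f b" for f
  proof (rule le_less_trans[OF nn_integral_mono fin0])
    fix b
    have "0 < gs 0 b * C" using C(1) pos(2)[of 0 b] by simp
    with that[of b] show "ennreal (1 / f b) \<le> ennreal (1 / (gs 0 b * C))"
      by (intro ennreal_leI divide_left_mono) auto
  qed
  have "\<exists>z>0. Z n = ennreal z" for n
    using int_pos[of "\<lambda>b. 1 / G n b"] le[of "G n"] G_ge G_pos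
    by (cases "Z n") (auto simp: Z_def)
  then obtain z where z: "\<And>n. z n > 0" "\<And>n. Z n = ennreal (z n)"
    by metis
  have "gs 0 b * C \<le> g (\<lambda>_. b)" for b
    using G_ge by (intro tendsto_lowerbound[OF G_lim[of b]]) auto
  then have "\<exists>z>0. Zinf = ennreal z"
    using int_pos[of "\<lambda>b. 1 / g (\<lambda>_. b)"] le[of "\<lambda>b. g (\<lambda>_. b)"] pos(1)
    by (cases Zinf) (auto simp: Zinf_def)
  then obtain c where c: "c > 0" "Zinf = ennreal c"
    by blast

  define p where "p n b = 1 / (G n b * z n)" for n b
  have p_pos: "p n b > 0" for n b
    by (simp add: p_def G_pos z(1))
  have "(\<integral>\<^sup>+b. ennreal (p n b) \<partial>count_space UNIV) = 1" for n
  proof -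
    have "(\<integral>\<^sup>+b. ennreal (p n b) \<partial>count_space UNIV) = ennreal (1 / z n) * Z n"
      unfolding Z_def using z(1)[of n] G_pos[of n]
      by (subst nn_integral_cmult[symmetric])
         (auto intro!: nn_integral_cong simp: p_def ennreal_mult[symmetric] less_imp_le mult.commute)
    also have "\<dots> = 1" using z(1)[of n] by (simp add: z(2) ennreal_mult[symmetric])
    finally show ?thesis .
  qed
  then have pmf: "pmf (embed_pmf (p n)) b = p n b" for n b
    by (intro pmf_embed_pmf) (auto simp: p_pos less_imp_le)
  define m where "m n = measure_pmf (embed_pmf (p n))" for n
  have m: "prob_family m"
    by (simp add: prob_family_def m_def prob_space_measure_pmf)
  have m_single: "emeasure (m n) {b} = ennreal (p n b)" for n b
    by (simp add: m_def emeasure_pmf_single pmf)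
  have m_int: "(\<integral>\<^sup>+b. f b \<partial>m n) = (\<integral>\<^sup>+b. ennreal (p n b) * f b \<partial>count_space UNIV)" for n f
    by (simp add: m_def nn_integral_measure_pmf pmf)

  \<comment> \<open>Since \<open>G (Suc n) b = G n b * gs (Suc n) b\<close>, the density
    \<open>1 / gs (Suc n)\<close> turns \<open>m n\<close> into a multiple of
    \<open>m (Suc n)\<close>. This matches the index shift caused by
    \<open>case_nat a\<close>.\<close>
  have m_Suc: "(\<integral>\<^sup>+b. f b * ennreal (1 / gs (Suc n) b) \<partial>m n) =
      ennreal (z (Suc n) / z n) * (\<integral>\<^sup>+b. f b \<partial>m (Suc n))" for f n
  proof -
    have "ennreal (p n b) * (f b * ennreal (1 / gs (Suc n) b)) =
        ennreal (z (Suc n) / z n) * (ennreal (p (Suc n) b) * f b)" for b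
    proof -
      have "p n b * (1 / gs (Suc n) b) = z (Suc n) / z n * p (Suc n) b"
        using z(1)[of n] z(1)[of "Suc n"] by (simp add: p_def G_Suc)
      then have "ennreal (p n b) * ennreal (1 / gs (Suc n) b) = ennreal (z (Suc n) / z n) * ennreal (p (Suc n) b)"
        using z(1) pos(2) p_pos by (subst (1 2) ennreal_mult[symmetric]) (auto simp: less_imp_le)
      then show ?thesis by (simp add: mult_ac)
    qed
    then show ?thesis by (simp add: m_int nn_integral_cmult)
  qed

  let ?M = "PiM UNIV m"
  interpret M: prob_space ?M by (rule prob_space_PiM_prob_family[OF m])
  note [measurable] = product_potential_measurable[OF g m] measurable_case_nat_PiM[OF m] sets_coord[OF m]
  have "density ?M (indicator {x. x 0 = a}) =
      distr (density ?M (\<lambda>y. ennreal (1 / (c * g (case_nat a y))))) ?M (case_nat a)" (is "?P = ?Q") for a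
  \<comment> \<open>Since \<open>?P\<close> is finite, agreement on cylinders over finitely many
    coordinates suffices.\<close>
  proof (rule measure_eqI_PiM_infinite)
    have UNIV_M: "UNIV \<in> sets ?M"
      using sets.top[of ?M] by (simp only: space_PiM_prob_family[OF m])
    have "emeasure ?P (space ?P) \<le> emeasure ?M (space ?M)"
      by (simp add: emeasure_density) (auto intro!: emeasure_mono simp: space_PiM_prob_family[OF m] UNIV_M)
    then show "finite_measure ?P"
      by (intro finite_measureI) (auto simp: M.emeasure_space_1 top_unique)
    fix A :: "nat \<Rightarrow> 'a set" and J :: "nat set"
    assume J: "finite J" and AJ: "\<And>i. i \<in> J \<Longrightarrow> A i \<in> sets (m i)"
    let ?E = "prod_emb UNIV m J (Pi\<^sub>E J A)"
    have E[measurable]: "?E \<in> sets ?M"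
      using J AJ by (intro sets_PiM_I) auto
    \<comment> \<open>Coordinates outside \<open>J\<close> get the factor 1, so the indicator of the
      cylinder is a product over any initial segment containing \<open>J\<close>.\<close>
    define h :: "nat \<Rightarrow> 'a \<Rightarrow> ennreal" where "h i = indicator (if i \<in> J then A i else UNIV)" for i
    obtain N\<^sub>0 where N\<^sub>0: "\<And>i. i \<in> J \<Longrightarrow> i < N\<^sub>0"
      using J finite_nat_set_iff_bounded by auto
    have ind: "indicator ?E x = (\<Prod>i<Suc N. h i (x i))" if "N\<^sub>0 \<le> N" for N x
    proof (cases "x \<in> ?E")
      case True
      then have "h i (x i) = 1" for i
        by (auto simp: h_def prod_emb_iff PiE_iff)
      then show ?thesis using True by simp
    next
      case False
      then obtain i where i: "i \<in> J" "x i \<notin> A i"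
        by (auto simp: prod_emb_iff PiE_iff prob_familyD[OF m])
      then have "h i (x i) = 0" "i < Suc N"
        using N\<^sub>0[of i] that by (auto simp: h_def)
      then have "(\<Prod>i<Suc N. h i (x i)) = 0"
        by (intro prod_zero) auto
      then show ?thesis using False by (simp only: indicator_simps not_False_eq_True)
    qed
    define H where "H N = (\<Prod>i<N. \<integral>\<^sup>+b. h (Suc i) b \<partial>m (Suc i))" for N
    have P: "emeasure ?P ?E = ennreal (p 0 a) * h 0 a * H N" if "N\<^sub>0 \<le> N" for N
    proof -
      \<comment> \<open>The branch condition is absorbed into the factor at coordinate 0, so the
        integrand stays a product.\<close>
      define h' where "h' i b = (if i = 0 then indicator {a} b * h i b else h i b)" for i b
      have "indicator {x. x 0 = a} x * indicator ?E x = (\<Prod>i<Suc N. h' i (x i))" for x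
        unfolding ind[OF that]
        by (simp add: prod.lessThan_Suc_shift h'_def indicator_def del: prod.lessThan_Suc)
      then have "emeasure ?P ?E = (\<integral>\<^sup>+x. (\<Prod>i<Suc N. h' i (x i)) \<partial>?M)"
        by (subst emeasure_density) simp_all
      also have "\<dots> = (\<Prod>i<Suc N. \<integral>\<^sup>+b. h' i b \<partial>m i)"
        by (rule nn_integral_PiM_prod[OF m])
      also have "\<dots> = (\<integral>\<^sup>+b. indicator {a} b * h 0 b \<partial>m 0) * H N"
        by (simp add: prod.lessThan_Suc_shift H_def h'_def del: prod.lessThan_Suc)
      also have "(\<integral>\<^sup>+b. indicator {a} b * h 0 b \<partial>m 0) = (\<integral>\<^sup>+b. h 0 a * indicator {a} b \<partial>m 0)"
        by (intro nn_integral_cong) (auto simp: indicator_def)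
      also have "\<dots> = ennreal (p 0 a) * h 0 a"
        by (simp add: nn_integral_cmult_indicator prob_familyD(2)[OF m] m_single mult.commute)
      finally show ?thesis .
    qed
    \<comment> \<open>The integrand for \<open>?Q\<close> with \<open>g\<close> cut off after its
      first \<open>Suc N\<close> factors; its integral can be computed exactly.\<close>
    define F where "F N y = ennreal (1 / (c * (\<Prod>i<Suc N. gs i (case_nat a y i)))) * indicator ?E (case_nat a y)" for N y
    have F_split: "(\<Prod>i<Suc N. gs i (case_nat a y i)) = gs 0 a * (\<Prod>i<N. gs (Suc i) (y i))" for N y
      by (simp add: prod.lessThan_Suc_shift del: prod.lessThan_Suc)
    have F_int: "(\<integral>\<^sup>+y. F N y \<partial>?M) = ennreal (z N / c) * emeasure ?P ?E" if "N\<^sub>0 \<le> N" for N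
    proof -
      have "F N y = ennreal (1 / (c * gs 0 a)) * h 0 a * (\<Prod>i<N. h (Suc i) (y i) * ennreal (1 / gs (Suc i) (y i)))" for y
      proof -
        have "ennreal (1 / (c * (\<Prod>i<Suc N. gs i (case_nat a y i)))) =
            ennreal (1 / (c * gs 0 a)) * (\<Prod>i<N. ennreal (1 / gs (Suc i) (y i)))"
          unfolding F_split using c(1) pos(2)
          by (simp add: prod_ennreal less_imp_le prod_nonneg ennreal_mult[symmetric] prod_dividef mult_ac)
        then show ?thesis
          by (simp add: F_def ind[OF that] prod.lessThan_Suc_shift prod.distrib mult_ac del: prod.lessThan_Suc)
      qed
      then have "(\<integral>\<^sup>+y. F N y \<partial>?M) = ennreal (1 / (c * gs 0 a)) * h 0 a *
          (\<integral>\<^sup>+y. (\<Prod>i<N. h (Suc i) (y i) * ennreal (1 / gs (Suc i) (y i))) \<partial>?M)"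
        by (simp only:) (intro nn_integral_cmult borel_measurable_prod_ennreal,
          rule measurable_coord[OF m, of "\<lambda>b. h (Suc i) b * ennreal (1 / gs (Suc i) b)" borel for i], simp)
      also have "(\<integral>\<^sup>+y. (\<Prod>i<N. h (Suc i) (y i) * ennreal (1 / gs (Suc i) (y i))) \<partial>?M) =
          (\<Prod>i<N. ennreal (z (Suc i) / z i)) * H N"
        by (subst nn_integral_PiM_prod[OF m, of "\<lambda>i b. h (Suc i) b * ennreal (1 / gs (Suc i) b)"])
           (simp add: m_Suc H_def prod.distrib)
      \<comment> \<open>The normalising ratios from \<open>m_Suc\<close> telescope;
        \<open>z 0\<close> is then absorbed into \<open>p 0 a\<close>.\<close>
      also have "(\<Prod>i<N. ennreal (z (Suc i) / z i)) = ennreal (z N / z 0)"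
      proof (induction N)
        case (Suc N)
        then show ?case using z(1) by (simp add: ennreal_mult[symmetric] less_imp_le less_imp_neq[symmetric])
      qed (use z(1)[of 0] in simp)
      also have "ennreal (1 / (c * gs 0 a)) * h 0 a * (ennreal (z N / z 0) * H N) =
          (ennreal (1 / (c * gs 0 a)) * ennreal (z N / z 0)) * (h 0 a * H N)"
        by (simp add: mult_ac)
      also have "ennreal (1 / (c * gs 0 a)) * ennreal (z N / z 0) = ennreal (z N / c) * ennreal (p 0 a)"
        using c(1) z(1) pos(2)[of 0 a] by (simp add: ennreal_mult[symmetric] less_imp_le p_def G_def mult_ac)
      finally show ?thesis by (simp add: P[OF that] mult_ac)
    qed
    \<comment> \<open>From \<open>N\<^sub>0\<close> on only the factor \<open>z N / c\<close>
      varies, and it tends to 1 by the choice of \<open>c\<close>.\<close>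
    have lim1: "(\<lambda>N. \<integral>\<^sup>+y. F N y \<partial>?M) \<longlonglongrightarrow> ennreal 1 * emeasure ?P ?E"
    proof (rule Lim_transform_eventually)
      have "(\<lambda>n. ennreal (z n)) \<longlonglongrightarrow> ennreal c"
        using Z_lim by (simp only: z(2)[symmetric] c(2)[symmetric])
      then have "z \<longlonglongrightarrow> c"
        using z(1) c(1) by (subst (asm) tendsto_ennreal_iff) (auto simp: less_imp_le)
      then have "(\<lambda>N. z N / c) \<longlonglongrightarrow> c / c"
        using c(1) by (intro tendsto_intros) auto
      then show "(\<lambda>N. ennreal (z N / c) * emeasure ?P ?E) \<longlonglongrightarrow> ennreal 1 * emeasure ?P ?E"
        using c(1) by (intro ennreal_tendsto_cmult tendsto_mult_ennreal tendsto_const tendsto_ennrealI) auto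
      show "\<forall>\<^sub>F N in sequentially. ennreal (z N / c) * emeasure ?P ?E = (\<integral>\<^sup>+y. F N y \<partial>?M)"
        using eventually_ge_at_top[of N\<^sub>0] by eventually_elim (simp add: F_int)
    qed
    have F_meas[measurable]: "F N \<in> borel_measurable ?M" for N
    proof -
      have [measurable]: "(\<lambda>y. gs i (y i)) \<in> borel_measurable ?M" for i
        by (rule measurable_coord[OF m]) simp
      have "(\<lambda>y. gs i (case_nat a y i)) \<in> borel_measurable ?M" for i
        by (rule measurable_compose[OF measurable_case_nat_PiM[OF m]]) measurable
      then show ?thesis unfolding F_def by measurable
    qed
    have "(\<lambda>N. \<integral>\<^sup>+y. F N y \<partial>?M) \<longlonglongrightarrow>
        (\<integral>\<^sup>+y. ennreal (1 / (c * g (case_nat a y))) * indicator ?E (case_nat a y) \<partial>?M)"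
    \<comment> \<open>The first factor is fixed at \<open>gs 0 a\<close> on the branch and the
      others have product at least \<open>C\<close>, so a constant dominates; it is integrable
      because \<open>?M\<close> has mass 1.\<close>
    proof (rule nn_integral_dominated_convergence[where w = "\<lambda>_. ennreal (1 / (c * (gs 0 a * C)))"])
      fix N
      have "F N y \<le> ennreal (1 / (c * (gs 0 a * C)))" for y
      proof -
        have "F N y \<le> ennreal (1 / (c * (\<Prod>i<Suc N. gs i (case_nat a y i))))"
          by (auto simp: F_def indicator_def)
        also have "\<dots> \<le> ennreal (1 / (c * (gs 0 a * C)))"
          unfolding F_split using c(1) C(1) C(2)[of y N] pos(2)
          by (intro ennreal_leI divide_left_mono mult_left_mono mult_pos_pos prod_pos) (auto simp: less_imp_le)
        finally show ?thesis .
      qed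
      then show "AE y in ?M. F N y \<le> ennreal (1 / (c * (gs 0 a * C)))" by simp
      have "(\<lambda>N. F N y) \<longlonglongrightarrow> ennreal (1 / (c * g (case_nat a y))) * indicator ?E (case_nat a y)" for y
      proof (cases "case_nat a y \<in> ?E")
        case True
        have "(\<lambda>N. ennreal (1 / (c * (\<Prod>i<Suc N. gs i (case_nat a y i))))) \<longlonglongrightarrow> ennreal (1 / (c * g (case_nat a y)))"
          using c(1) pos(1)[of "case_nat a y"]
          by (intro tendsto_ennrealI tendsto_intros product_potential_LIMSEQ[OF g, THEN LIMSEQ_Suc]) auto
        then show ?thesis using True by (simp add: F_def)
      qed (simp add: F_def)
      then show "AE y in ?M. (\<lambda>N. F N y) \<longlonglongrightarrow> ennreal (1 / (c * g (case_nat a y))) * indicator ?E (case_nat a y)"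
        by simp
    qed (auto simp: M.emeasure_space_1)
    from LIMSEQ_unique[OF lim1 this]
    show "emeasure ?P ?E = emeasure ?Q ?E"
      by (simp add: emeasure_distr emeasure_density measurable_sets) (auto intro!: nn_integral_cong simp: indicator_def space_PiM_prob_family[OF m])
  qed simp_all
  then have "conformal g ?M"
    by (rule conformalI[OF m g c(1)])
  moreover have "positive_on_open ?M"
    by (rule positive_on_open_PiM[OF m]) (simp add: m_single p_pos)
  ultimately show ?thesis using m by blast
qed

theorem theorem3p1:
  fixes g :: "(nat \<Rightarrow> 'a::{countable,discrete_topology}) \<Rightarrow> real"
    and gs :: "nat \<Rightarrow> 'a \<Rightarrow> real"
  assumes "product_potential g gs"
  shows "(\<exists>\<^sub>\<le>\<^sub>1 \<mu>. product_type_measure \<mu> \<and> conformal g \<mu> \<and> positive_on_open \<mu>) \<and>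
    (\<forall>m. prob_family m \<longrightarrow> conformal g (PiM UNIV m) \<longrightarrow> positive_on_open (PiM UNIV m) \<longrightarrow>
       (\<forall>n a. emeasure (m n) {a} =
          inverse (\<Sum>\<^sub>\<infinity>b. ennreal (\<Prod>i\<le>n. gs i a / gs i b)))) \<and>
    ((INF x. g x) > 0 \<longrightarrow> (\<lambda>b. 1 / gs 0 b) summable_on UNIV \<longrightarrow>
       (\<exists>\<mu>. product_type_measure \<mu> \<and> conformal g \<mu> \<and> positive_on_open \<mu>))"
proof (intro conjI allI impI Uniq_I)
  fix \<mu> \<nu>
  assume "product_type_measure \<mu> \<and> conformal g \<mu> \<and> positive_on_open \<mu>"
    and "product_type_measure \<nu> \<and> conformal g \<nu> \<and> positive_on_open \<nu>"
  then obtain m m' where m: "prob_family m" "\<mu> = PiM UNIV m" "conformal g \<mu>" "positive_on_open \<mu>"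
    and m': "prob_family m'" "\<nu> = PiM UNIV m'" "conformal g \<nu>" "positive_on_open \<nu>"
    unfolding product_type_measure_def by blast
  \<comment> \<open>Both marginals have the singleton weights given by the formula, which determine
    a measure on a countable alphabet.\<close>
  have "m n = m' n" for n
    using m m' by (intro measure_eqI_countable[of _ UNIV])
      (simp_all add: prob_familyD(2) conformal_product_marginals[OF assms])
  then have "m = m'" by (rule ext)
  with m m' show "\<mu> = \<nu>" by simp
next
  fix m :: "nat \<Rightarrow> 'a measure" and n a
  assume "prob_family m" "conformal g (PiM UNIV m)" "positive_on_open (PiM UNIV m)"
  then show "emeasure (m n) {a} = inverse (\<Sum>\<^sub>\<infinity>b. ennreal (\<Prod>i\<le>n. gs i a / gs i b))"
    by (rule conformal_product_marginals[OF assms])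
next
  assume "(INF x. g x) > 0" "(\<lambda>b. 1 / gs 0 b) summable_on UNIV"
  then show "\<exists>\<mu>. product_type_measure \<mu> \<and> conformal g \<mu> \<and> positive_on_open \<mu>"
    using conformal_product_exists[OF assms] unfolding product_type_measure_def by blast
qed

end
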